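(* Let $\Lambda=\{1,\dots,N\}$, let $X_i\subseteq\mathbb{R}^{n_i}$ be non-empty convex sets, and let $K_i:X\rightrightarrows\mathbb{R}^{n_i}$ and $P_i:\mathbb{R}^n\rightrightarrows\mathbb{R}^{n_i}$ ($i\in\Lambda$), where $n=\sum_{i\in\Lambda}n_i$ and $X=\prod_{i\in\Lambda}X_i$. Let $K:X\rightrightarrows\mathbb{R}^n$ be $K(x)=\prod_{i\in\Lambda}K_i(x)$ and let $T:\mathbb{R}^n\rightrightarrows\mathbb{R}^n$ be the map built from the $P_i$ as in the context. Suppose that for each $i\in\Lambda$: (a) $P_i(y)$ is convex for every $y\in\prod_{j\in\Lambda}co(\overline{K_j(X)})$; (b) $y_i\in cl(P_i(y))$ for all $y\in\prod_{j\in\Lambda}co(\overline{K_j(X)})$ with $P_i(y)\neq\emptyset$; (c) $K_i$ has non-empty, closed and convex values. Then any projected solution of the generalized Nash game $\Gamma=(X_i,K_i,P_i)_{i\in\Lambda}$ is a projected solution of the quasi-variational inequality $QVI(T,K)$.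
   Context: $n_i\ge 1$ are integers. All spaces carry the Euclidean inner product $\langle\cdot,\cdot\rangle$ and norm. $A\rightrightarrows B$ denotes a multi-valued map (each point of $A$ is sent to a possibly empty subset of $B$). $co$ denotes convex hull, $cl$ and an overline denote closure, and $K_i(X)=\bigcup_{x\in X}K_i(x)$. A vector $x\in\mathbb{R}^n$ is written $x=(x_i)_{i\in\Lambda}=(x_{-i},x_i)$ with $x_i\in\mathbb{R}^{n_i}$. Definition of $T$: put $\tilde P_i(x)=co(P_i(x))$ and $$\mathcal N_{\tilde P_i}(x)=\{x_i^*\in\mathbb{R}^{n_i}\mid \langle x_i^*,z_i-x_i\rangle\le 0\ \text{for all } z_i\in\tilde P_i(x)\}$$ (so $\mathcal N_{\tilde P_i}(x)=\mathbb{R}^{n_i}$ if $\tilde P_i(x)=\emptyset$). Let $S_i[0,1]=\{v\in\mathbb{R}^{n_i}\mid\|v\|=1\}$, $T_i(x)=co(\mathcal N_{\tilde P_i}(x)\cap S_i[0,1])$ and $T(x)=\prod_{i\in\Lambda}T_i(x)$. Projected solution of $QVI(T,K)$: a vector $\tilde x\in X$ for which there exists $\tilde y\in\mathbb{R}^n$ such that (i) $\|\tilde y-\tilde x\|=\inf_{w\in X}\|\tilde y-w\|$ and (ii) $\tilde y\in K(\tilde x)$ and there is $\tilde y^*\in T(\tilde y)$ with $\langle\tilde y^*,z-\tilde y\rangle\ge0$ for all $z\in K(\tilde x)$. Projected solution of $\Gamma=(X_i,K_i,P_i)_{i\in\Lambda}$: a vector $\tilde x\in X$ for which there exists $\tilde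 y=(\tilde y_i)_{i\in\Lambda}\in\mathbb{R}^n$ such that (i) $\|\tilde y-\tilde x\|=\inf_{w\in X}\|\tilde y-w\|$ and (ii) for every $i\in\Lambda$, $\tilde y_i\in K_i(\tilde x)$ and $P_i(\tilde y)\cap K_i(\tilde x)=\emptyset$. *)

theory Defs
  imports "HOL-Analysis.Analysis"
begin

text \<open>
  The dimensions \<open>n\<^sub>i\<close> vary with the player \<open>i\<close>, so the product of the spaces \<open>\<real>\<^bsup>n\<^sub>i\<^esup>\<close> is the single
  space \<open>\<real>\<^bsup>n\<^esup>\<close> (type \<open>real ^ 'n\<close>) together with a map \<open>blk\<close> that assigns to each coordinate its
  player.  The factor \<open>\<real>\<^bsup>n\<^sub>i\<^esup>\<close> is the coordinate subspace \<open>factor_space blk i\<close>, with the inner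
  product, norm, closure and convex hull inherited from \<open>\<real>\<^bsup>n\<^esup>\<close>; the component \<open>x\<^sub>i\<close> of \<open>x\<close> is the
  restriction of \<open>x\<close> to the coordinates of \<open>i\<close>, extended by zero.
\<close>

definition coordinate_blocks :: "nat \<Rightarrow> (nat \<Rightarrow> nat) \<Rightarrow> ('n::finite \<Rightarrow> nat) \<Rightarrow> bool" where
  "coordinate_blocks N n blk \<longleftrightarrow>
     (\<forall>k. blk k \<in> {1..N}) \<and> (\<forall>i\<in>{1..N}. card {k. blk k = i} = n i)"

definition factor_space :: "('n::finite \<Rightarrow> nat) \<Rightarrow> nat \<Rightarrow> (real ^ 'n) set" where
  "factor_space blk i = {v. \<forall>k. blk k \<noteq> i \<longrightarrow> v $ k = 0}"

definition component :: "('n::finite \<Rightarrow> nat) \<Rightarrow> nat \<Rightarrow> real ^ 'n \<Rightarrow> real ^ 'n" where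
  "component blk i x = (\<chi> k. if blk k = i then x $ k else 0)"

definition factor_prod ::
    "nat \<Rightarrow> ('n::finite \<Rightarrow> nat) \<Rightarrow> (nat \<Rightarrow> (real ^ 'n) set) \<Rightarrow> (real ^ 'n) set" where
  "factor_prod N blk A = {x. \<forall>i\<in>{1..N}. component blk i x \<in> A i}"

text \<open>Every tuple \<open>(n\<^sub>1, \<dots>, n\<^sub>N)\<close> with sum \<open>CARD('n)\<close> is realised by some \<open>blk\<close>, and the
  factors then have the right dimensions.\<close>

lemma coordinate_blocks_exist:
  assumes "CARD('n::finite) = (\<Sum>i=1..N. n i)"
  shows "\<exists>blk :: 'n \<Rightarrow> nat. coordinate_blocks N n blk"
proof -
  let ?S = "SIGMA i:{1..N}. {..<n i}"
  have "card (UNIV :: 'n set) = card ?S"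
    using assms by (simp add: card_SigmaI)
  then obtain f :: "'n \<Rightarrow> nat \<times> nat" where f: "bij_betw f UNIV ?S"
    using finite_same_card_bij[of "UNIV :: 'n set" ?S] by auto
  have inS: "f k \<in> ?S" for k
    using f by (auto simp: bij_betw_def)
  have "card {k. fst (f k) = i} = n i" if i: "i \<in> {1..N}" for i
  proof -
    have "f ` {k. fst (f k) = i} = {i} \<times> {..<n i}"
    proof
      show "f ` {k. fst (f k) = i} \<subseteq> {i} \<times> {..<n i}"
      proof
        fix p assume "p \<in> f ` {k. fst (f k) = i}"
        then obtain k where "p = f k" "fst (f k) = i" by auto
        with inS[of k] show "p \<in> {i} \<times> {..<n i}" by (cases "f k") auto
      qed
      show "{i} \<times> {..<n i} \<subseteq> f ` {k. fst (f k) = i}"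
      proof
        fix p assume p: "p \<in> {i} \<times> {..<n i}"
        then have "p \<in> f ` UNIV" using f i by (auto simp: bij_betw_def)
        then obtain k where "p = f k" by blast
        then show "p \<in> f ` {k. fst (f k) = i}" using p by auto
      qed
    qed
    moreover have "inj_on f {k. fst (f k) = i}"
      using f by (auto simp: bij_betw_def inj_on_def)
    ultimately show ?thesis
      using card_image[of f "{k. fst (f k) = i}"] by (simp add: card_cartesian_product)
  qed
  moreover have "fst (f k) \<in> {1..N}" for k
    using inS[of k] by (cases "f k") auto
  ultimately have "coordinate_blocks N n (fst \<circ> f)"
    by (simp add: coordinate_blocks_def)
  then show ?thesis by blast
qed

lemma dim_factor_space:
  assumes "coordinate_blocks N n blk" "i \<in> {1..N}"
  shows "dim (factor_space blk i) = n i"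
proof -
  have "factor_space blk i = {v. \<forall>k. k \<notin> {k. blk k = i} \<longrightarrow> v $ k = 0}"
    by (simp add: factor_space_def)
  then show ?thesis
    using assms dim_substandard_cart[of "{k. blk k = i}", where 'a=real]
    by (simp add: coordinate_blocks_def dim_vec_eq)
qed

definition normal_cone_at ::
    "('n::finite \<Rightarrow> nat) \<Rightarrow> (nat \<Rightarrow> real ^ 'n \<Rightarrow> (real ^ 'n) set) \<Rightarrow> nat \<Rightarrow> real ^ 'n
      \<Rightarrow> (real ^ 'n) set" where
  "normal_cone_at blk P i x =
     {v \<in> factor_space blk i. \<forall>z \<in> convex hull (P i x). v \<bullet> (z - component blk i x) \<le> 0}"

definition factor_sphere :: "('n::finite \<Rightarrow> nat) \<Rightarrow> nat \<Rightarrow> (real ^ 'n) set" where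
  "factor_sphere blk i = {v \<in> factor_space blk i. norm v = 1}"

definition player_operator ::
    "('n::finite \<Rightarrow> nat) \<Rightarrow> (nat \<Rightarrow> real ^ 'n \<Rightarrow> (real ^ 'n) set) \<Rightarrow> nat \<Rightarrow> real ^ 'n
      \<Rightarrow> (real ^ 'n) set" where
  "player_operator blk P i x = convex hull (normal_cone_at blk P i x \<inter> factor_sphere blk i)"

definition game_operator ::
    "nat \<Rightarrow> ('n::finite \<Rightarrow> nat) \<Rightarrow> (nat \<Rightarrow> real ^ 'n \<Rightarrow> (real ^ 'n) set) \<Rightarrow> real ^ 'n
      \<Rightarrow> (real ^ 'n) set" where
  "game_operator N blk P x = factor_prod N blk (\<lambda>i. player_operator blk P i x)"

definition projected_solution_QVI ::
    "'a::real_inner set \<Rightarrow> ('a \<Rightarrow> 'a set) \<Rightarrow> ('a \<Rightarrow> 'a set) \<Rightarrow> 'a \<Rightarrow> bool" where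
  "projected_solution_QVI X T K x \<longleftrightarrow>
     x \<in> X \<and>
     (\<exists>y. norm (y - x) = (INF w\<in>X. norm (y - w)) \<and>
          y \<in> K x \<and> (\<exists>ystar \<in> T y. \<forall>z \<in> K x. ystar \<bullet> (z - y) \<ge> 0))"

definition projected_solution_game ::
    "nat \<Rightarrow> ('n::finite \<Rightarrow> nat) \<Rightarrow> (nat \<Rightarrow> (real ^ 'n) set)
      \<Rightarrow> (nat \<Rightarrow> real ^ 'n \<Rightarrow> (real ^ 'n) set) \<Rightarrow> (nat \<Rightarrow> real ^ 'n \<Rightarrow> (real ^ 'n) set)
      \<Rightarrow> real ^ 'n \<Rightarrow> bool" where
  "projected_solution_game N blk Xs K P x \<longleftrightarrow>
     x \<in> factor_prod N blk Xs \<and>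
     (\<exists>y. norm (y - x) = (INF w \<in> factor_prod N blk Xs. norm (y - w)) \<and>
          (\<forall>i\<in>{1..N}. component blk i y \<in> K i x \<and> P i y \<inter> K i x = {}))"

end

theory Submission
  imports Defs
begin

text \<open>
  Let \<open>y\<close> be the point that the game solution \<open>x\<close> is a projection of.  For each player a vector
  \<open>u\<^sub>i \<in> T\<^sub>i(y)\<close> with \<open>u\<^sub>i \<bullet> (z - y\<^sub>i) \<ge> 0\<close> on \<open>K\<^sub>i(x)\<close> is found, and these vectors are added up.

  If \<open>P\<^sub>i(y)\<close> is non-empty, then it and \<open>K\<^sub>i(x)\<close> are disjoint convex sets, so some hyperplane of
  the factor \<open>\<real>\<^bsup>n\<^sub>i\<^esup>\<close> separates them.  As \<open>y\<^sub>i\<close> lies in \<open>K\<^sub>i(x)\<close> and in the closure of \<open>P\<^sub>i(y)\<close>, the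
  hyperplane passes through \<open>y\<^sub>i\<close>; its unit normal on the side of \<open>K\<^sub>i(x)\<close> therefore belongs to the
  normal cone of \<open>P\<^sub>i(y)\<close> at \<open>y\<^sub>i\<close> and is the wanted vector
  (\<open>separating_unit_normal_in_subspace\<close>).  If \<open>P\<^sub>i(y)\<close> is empty, then
  \<open>T\<^sub>i(y)\<close> is the convex hull of the whole unit sphere and contains \<open>u\<^sub>i = 0\<close>
  (\<open>zero_in_player_operator\<close>).  The sum works
  because distinct factors are orthogonal: the pairing of \<open>\<Sum>\<^sub>i u\<^sub>i\<close> with \<open>z - y\<close> is the sum of the
  pairings in the factors (\<open>inner_sum_factors\<close>).
\<close>

lemma subspace_factor_space: "subspace (factor_space blk i)"
  by (auto simp: subspace_def factor_space_def)

lemma inner_component: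
  assumes "u \<in> factor_space blk i"
  shows "u \<bullet> component blk i w = u \<bullet> w"
  using assms by (auto simp: inner_vec_def component_def factor_space_def intro!: sum.cong)

lemma inner_sum_factors:
  assumes "\<And>i. i \<in> I \<Longrightarrow> u i \<in> factor_space blk i"
  shows "(\<Sum>i\<in>I. u i) \<bullet> (z - y) = (\<Sum>i\<in>I. u i \<bullet> (component blk i z - component blk i y))"
proof -
  have "u i \<bullet> (component blk i z - component blk i y) = u i \<bullet> (z - y)" if "i \<in> I" for i
    using inner_component[OF assms[OF that]] by (simp add: inner_diff_right)
  then show ?thesis
    by (simp add: inner_sum_left)
qed

lemma component_sum_factors:
  assumes "finite I" "i \<in> I" and u: "\<And>j. j \<in> I \<Longrightarrow> u j \<in> factor_space blk j"
  shows "component blk i (\<Sum>j\<in>I. u j) = u i"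
proof -
  have "(\<Sum>j\<in>I. u j $ k) = u i $ k" if "blk k = i" for k
  proof -
    have "(\<Sum>j\<in>I. u j $ k) = (\<Sum>j\<in>I. if j = i then u i $ k else 0)"
      using u that by (intro sum.cong) (auto simp: factor_space_def)
    then show ?thesis using assms by simp
  qed
  moreover have "u i $ k = 0" if "blk k \<noteq> i" for k
    using u[OF \<open>i \<in> I\<close>] that by (simp add: factor_space_def)
  ultimately show ?thesis
    by (auto simp: vec_eq_iff component_def)
qed

text \<open>
  Separating the two sets in the ambient space could produce a normal orthogonal to the
  subspace, whose part in the subspace would vanish.  Separating their difference set from the
  origin instead gives a normal in the span of the differences.
\<close>

lemma separating_unit_normal_in_subspace:
  fixes V P K :: "'a::euclidean_space set"
  assumes V: "subspace V" "P \<subseteq> V" "K \<subseteq> V"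
    and P: "convex P" "P \<noteq> {}" and K: "convex K" and disj: "P \<inter> K = {}"
    and p: "p \<in> K" "p \<in> closure P"
  obtains u where "u \<in> V" "norm u = 1"
    "\<And>z. z \<in> P \<Longrightarrow> u \<bullet> (z - p) \<le> 0" "\<And>z. z \<in> K \<Longrightarrow> 0 \<le> u \<bullet> (z - p)"
proof -
  let ?D = "{k - q | k q. k \<in> K \<and> q \<in> P}"
  have "?D = (\<Union>k\<in>K. \<Union>q\<in>P. {k - q})" by auto
  with convex_differences[OF K P(1)] have "convex ?D" by simp
  moreover have "?D \<noteq> {}" "0 \<notin> ?D" using P(2) p disj by auto
  ultimately obtain a where a: "a \<in> span ?D" "a \<noteq> 0" "\<And>d. d \<in> ?D \<Longrightarrow> 0 \<le> a \<bullet> d"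
    using separating_hyperplane_set_0_inspan[of ?D] by blast
  have "?D \<subseteq> V" using V by (auto intro: subspace_diff)
  then have aV: "a \<in> V" using a(1) span_minimal[OF _ V(1)] by blast
  have le: "a \<bullet> q \<le> a \<bullet> k" if "k \<in> K" "q \<in> P" for k q
    using a(3)[of "k - q"] that by (auto simp: inner_diff_right)
  \<comment> \<open>The closure hypothesis puts \<open>p\<close> on the same side of the hyperplane as \<open>P\<close>.\<close>
  have le_closure: "a \<bullet> p \<le> a \<bullet> k" if "k \<in> K" for k
  proof -
    have "closure P \<subseteq> {w. a \<bullet> w \<le> a \<bullet> k}"
      using le[OF that] by (intro closure_minimal closed_halfspace_le) auto
    then show ?thesis using p(2) by auto
  qed
  show thesis
  proof
    show "a /\<^sub>R norm a \<in> V" using aV V(1) by (simp add: subspace_scale)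
    show "norm (a /\<^sub>R norm a) = 1" using a(2) by simp
    show "(a /\<^sub>R norm a) \<bullet> (z - p) \<le> 0" if "z \<in> P" for z
      using le[OF p(1) that] by (simp add: inner_diff_right mult_left_mono)
    show "0 \<le> (a /\<^sub>R norm a) \<bullet> (z - p)" if "z \<in> K" for z
      using le_closure[OF that] by (simp add: inner_diff_right mult_left_mono)
  qed
qed

text \<open>
  With no preferred points the normal cone is the whole factor, and the origin is the midpoint
  of two antipodal unit vectors; those exist because the factor is not trivial.
\<close>

lemma zero_in_player_operator:
  assumes "P i y = {}" and k: "blk k = i"
  shows "0 \<in> player_operator blk P i y"
proof -
  let ?S = "normal_cone_at blk P i y \<inter> factor_sphere blk i"
  have "axis k (1::real) \<in> factor_space blk i" "- axis k (1::real) \<in> factor_space blk i"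
    using k by (auto simp: factor_space_def axis_def)
  then have "axis k 1 \<in> ?S" "- axis k 1 \<in> ?S"
    using assms by (auto simp: normal_cone_at_def factor_sphere_def)
  then have "(1/2) *\<^sub>R axis k (1::real) + (1/2) *\<^sub>R (- axis k 1) \<in> convex hull ?S"
    by (intro convexD convex_convex_hull hull_inc) auto
  then show ?thesis
    by (simp add: player_operator_def)
qed

lemma player_operator_subset_factor_space:
  "player_operator blk P i y \<subseteq> factor_space blk i"
  unfolding player_operator_def
  by (rule hull_minimal)
    (auto simp: factor_sphere_def intro: subspace_imp_convex subspace_factor_space)

theorem theorem3p2:
  fixes N :: nat
    and n :: "nat \<Rightarrow> nat"
    and blk :: "'n::finite \<Rightarrow> nat"
    and Xs :: "nat \<Rightarrow> (real ^ 'n) set"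
    and K P :: "nat \<Rightarrow> real ^ 'n \<Rightarrow> (real ^ 'n) set"
    and X C :: "(real ^ 'n) set"
    and x :: "real ^ 'n"
  assumes n_pos: "\<And>i. i \<in> {1..N} \<Longrightarrow> n i \<ge> 1"
    and blocks: "coordinate_blocks N n blk"
    and Xs: "\<And>i. i \<in> {1..N} \<Longrightarrow> Xs i \<subseteq> factor_space blk i \<and> Xs i \<noteq> {} \<and> convex (Xs i)"
    and X: "X = factor_prod N blk Xs"
    and K_type: "\<And>i x. i \<in> {1..N} \<Longrightarrow> x \<in> X \<Longrightarrow> K i x \<subseteq> factor_space blk i"
    and P_type: "\<And>i y. i \<in> {1..N} \<Longrightarrow> P i y \<subseteq> factor_space blk i"
    and C: "C = factor_prod N blk (\<lambda>j. convex hull (closure (\<Union>x\<in>X. K j x)))"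
    and a: "\<And>i y. i \<in> {1..N} \<Longrightarrow> y \<in> C \<Longrightarrow> convex (P i y)"
    and b: "\<And>i y. i \<in> {1..N} \<Longrightarrow> y \<in> C \<Longrightarrow> P i y \<noteq> {} \<Longrightarrow> component blk i y \<in> closure (P i y)"
    and c: "\<And>i x. i \<in> {1..N} \<Longrightarrow> x \<in> X \<Longrightarrow> K i x \<noteq> {} \<and> closed (K i x) \<and> convex (K i x)"
    and sol: "projected_solution_game N blk Xs K P x"
  shows "projected_solution_QVI X (game_operator N blk P)
           (\<lambda>x. factor_prod N blk (\<lambda>i. K i x)) x"
proof -
  from sol obtain y where xX: "x \<in> X"
    and proj: "norm (y - x) = (INF w\<in>X. norm (y - w))"
    and yK: "\<And>i. i \<in> {1..N} \<Longrightarrow> component blk i y \<in> K i x"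
    and disj: "\<And>i. i \<in> {1..N} \<Longrightarrow> P i y \<inter> K i x = {}"
    unfolding projected_solution_game_def X by blast
  have "K j x \<subseteq> convex hull (closure (\<Union>x\<in>X. K j x))" for j
    using xX closure_subset hull_subset by fast
  with yK have yC: "y \<in> C"
    unfolding C factor_prod_def by blast
  have "\<exists>u. u \<in> player_operator blk P i y \<and> (\<forall>z\<in>K i x. 0 \<le> u \<bullet> (z - component blk i y))"
    if i: "i \<in> {1..N}" for i
  proof (cases "P i y = {}")
    case True
    have "card {k. blk k = i} \<noteq> 0"
      using blocks n_pos[OF i] i by (force simp: coordinate_blocks_def)
    then obtain k where "blk k = i" by fastforce
    with True have "0 \<in> player_operator blk P i y" by (rule zero_in_player_operator)
    then show ?thesis by (intro exI[of _ 0]) simp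
  next
    case False
    obtain u where u: "u \<in> factor_space blk i" "norm u = 1"
      "\<And>z. z \<in> P i y \<Longrightarrow> u \<bullet> (z - component blk i y) \<le> 0"
      "\<And>z. z \<in> K i x \<Longrightarrow> 0 \<le> u \<bullet> (z - component blk i y)"
      using separating_unit_normal_in_subspace[OF subspace_factor_space P_type[OF i] K_type[OF i xX]
          a[OF i yC] False conjunct2[OF conjunct2[OF c[OF i xX]]] disj[OF i] yK[OF i]
          b[OF i yC False]] by metis
    have "convex hull (P i y) = P i y"
      using a[OF i yC] by (rule hull_same)
    with u have "u \<in> normal_cone_at blk P i y \<inter> factor_sphere blk i"
      by (simp add: normal_cone_at_def factor_sphere_def)
    then have "u \<in> player_operator blk P i y"
      unfolding player_operator_def by (rule hull_inc)
    with u(4) show ?thesis by blast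
  qed
  then obtain u where uT: "\<And>i. i \<in> {1..N} \<Longrightarrow> u i \<in> player_operator blk P i y"
    and uK: "\<And>i z. i \<in> {1..N} \<Longrightarrow> z \<in> K i x \<Longrightarrow> 0 \<le> u i \<bullet> (z - component blk i y)"
    by metis
  have uV: "u i \<in> factor_space blk i" if "i \<in> {1..N}" for i
    using uT[OF that] player_operator_subset_factor_space by blast
  let ?ystar = "\<Sum>i\<in>{1..N}. u i"
  have "?ystar \<in> game_operator N blk P y"
    using uT component_sum_factors[OF _ _ uV, of "{1..N}"]
    by (simp add: game_operator_def factor_prod_def)
  moreover have "0 \<le> ?ystar \<bullet> (z - y)" if "z \<in> factor_prod N blk (\<lambda>i. K i x)" for z
    using that uK inner_sum_factors[OF uV, of "{1..N}" z y]
    by (auto simp: factor_prod_def intro!: sum_nonneg)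
  moreover have "y \<in> factor_prod N blk (\<lambda>i. K i x)"
    using yK by (simp add: factor_prod_def)
  ultimately show ?thesis
    unfolding projected_solution_QVI_def using xX proj by blast
qed

end
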